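(* Let $r\ge 1$, let $P$ be an $(r\times r)$ covariance matrix, and let $(Q_i)_{i\ge 1}$ be any collection of (deterministic, real) $(r\times r)$-matrices. For any integers $N,n$ with $2N\ge n\ge 1$ we have $$\mathbb{E}\left[(Q_1\mathcal{H}_N)\cdots(Q_n\mathcal{H}_N)\right]=\sum_{1\le m\le\lfloor n/2\rfloor}\frac{1}{N^{n/2-m}}\,\partial^{[Q]}_{n,m}(P)\quad\text{with}\quad \partial^{[Q]}_{n,m}(P):=\sum_{m\le l\le\lfloor n/2\rfloor}s(l,m)\,M^{[Q]}_{n,l}(P).$$ In addition, $$\mathbb{E}\left[(Q_1P_N)\cdots(Q_nP_N)\right]=\sum_{1\le m\le n}\frac{1}{N^{n-m}}\,\partial^{\circ,[Q]}_{n,m}(P)\quad\text{with}\quad \partial^{\circ,[Q]}_{n,m}(P):=\sum_{m\le l\le n}s(l,m)\,M^{\circ,[Q]}_{n,l}(P).$$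
   Context: $X$ is a centered Gaussian column vector in $\mathbb{R}^r$ with covariance matrix $P$, $\mathbb{X}:=XX'$ ($'$ denotes transpose), and $\mathbb{X}_1,\mathbb{X}_2,\ldots$ are independent copies of $\mathbb{X}$. $P_N:=N^{-1}\sum_{1\le i\le N}\mathbb{X}_i$ and $\mathcal{H}_N:=\sqrt{N}(P_N-P)=N^{-1/2}\sum_{1\le i\le N}(\mathbb{X}_i-P)$. Products of matrices are taken in increasing order of the index, from left to right. $\mathcal{P}_{n,m}$ is the set of partitions of $[n]=\{1,\ldots,n\}$ into $m$ blocks $\pi_1\le\cdots\le\pi_m$, ordered by their smallest elements; $\mathcal{Q}_{n,m}\subset\mathcal{P}_{n,m}$ is the subset of partitions having no singleton block. For $\pi\in\mathcal{P}_{n,m}$, $\alpha^\pi(i)$ denotes the index of the block of $\pi$ containing $i\in[n]$. Define $$M^{[Q]}_{\pi}(P):=\mathbb{E}\Big(\prod_{1\le i\le n}\big[Q_i(\mathbb{X}_{\alpha^\pi(i)}-P)\big]\Big),\qquad M^{\circ,[Q]}_{\pi}(P):=\mathbb{E}\Big(\prod_{1\le i\le n}\big[Q_i\mathbb{X}_{\alpha^\pi(i)}\big]\Big),$$ $$M^{[Q]}_{n,m}(P):=\sum_{\pi\in\mathcal{Q}_{n,m}}M^{[Q]}_\pi(P),\qquad M^{\circ,[Q]}_{n,m}(P):=\sum_{\pi\in\mathcal{P}_{n,m}}M^{\circ,[Q]}_\pi(P).$$ $s(l,m)$ are the (signed) Stirling numbers of the first kind, i.e. $x(x-1)\cdots(x-l+1)=\sum_{1\le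 m\le l}s(l,m)x^m$ for $l\geq 1$. Empty sums are zero. *)

theory Defs
  imports
    "HOL-Probability.Probability"
    "HOL-Computational_Algebra.Polynomial"
    "HOL-Combinatorics.Stirling"
begin

section \<open>Gaussian vectors\<close>

text \<open>The one-dimensional normal law with mean \<open>\<mu>\<close> and variance \<open>v \<ge> 0\<close>; it degenerates to a
  Dirac mass when \<open>v = 0\<close>, so that singular covariance matrices are covered.\<close>

definition normal_law :: "real \<Rightarrow> real \<Rightarrow> real measure" where
  "normal_law \<mu> v =
     (if v = 0 then return borel \<mu> else density lborel (\<lambda>x. ennreal (normal_density \<mu> (sqrt v) x)))"

definition gaussian_vector :: "'a measure \<Rightarrow> ('a \<Rightarrow> real ^ 'r) \<Rightarrow> bool" where
  "gaussian_vector M X \<longleftrightarrow>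
     X \<in> borel_measurable M \<and>
     (\<forall>u. \<exists>\<mu> v. 0 \<le> v \<and> distr M borel (\<lambda>\<omega>. u \<bullet> X \<omega>) = normal_law \<mu> v)"

definition covariance_matrix :: "'a measure \<Rightarrow> ('a \<Rightarrow> real ^ 'r) \<Rightarrow> real ^ 'r ^ 'r" where
  "covariance_matrix M X =
     (\<chi> i j. \<integral>\<omega>. (X \<omega> $ i - (\<integral>\<eta>. X \<eta> $ i \<partial>M)) * (X \<omega> $ j - (\<integral>\<eta>. X \<eta> $ j \<partial>M)) \<partial>M)"

definition outer_square :: "real ^ 'r \<Rightarrow> real ^ 'r ^ 'r" where
  "outer_square x = (\<chi> i j. x $ i * x $ j)"

lemma outer_square_eq_column_row:
  "outer_square x = (columnvector x :: real ^ 1 ^ 'r) ** (rowvector x :: real ^ 'r ^ 1)"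
  by (simp add: outer_square_def matrix_matrix_mult_def columnvector_def rowvector_def)


section \<open>Sample covariance matrices\<close>

text \<open>The ordered product \<open>A 1 ** A 2 ** \<dots> ** A n\<close>.\<close>

primrec mat_prod :: "(nat \<Rightarrow> real ^ 'r ^ 'r) \<Rightarrow> nat \<Rightarrow> real ^ 'r ^ 'r" where
  "mat_prod A 0 = mat 1"
| "mat_prod A (Suc n) = mat_prod A n ** A (Suc n)"

text \<open>Throughout, \<open>Y i\<close> for \<open>i \<ge> 1\<close> are the independent copies of the random matrix \<open>X X'\<close>; the value
  \<open>Y 0\<close> is never used.\<close>

definition sample_cov :: "(nat \<Rightarrow> 'a \<Rightarrow> real ^ 'r ^ 'r) \<Rightarrow> nat \<Rightarrow> 'a \<Rightarrow> real ^ 'r ^ 'r" where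
  "sample_cov Y N \<omega> = (1 / real N) *\<^sub>R (\<Sum>i=1..N. Y i \<omega>)"

definition cov_fluctuation ::
    "(nat \<Rightarrow> 'a \<Rightarrow> real ^ 'r ^ 'r) \<Rightarrow> real ^ 'r ^ 'r \<Rightarrow> nat \<Rightarrow> 'a \<Rightarrow> real ^ 'r ^ 'r" where
  "cov_fluctuation Y P N \<omega> = sqrt (real N) *\<^sub>R (sample_cov Y N \<omega> - P)"


section \<open>Partitions and matrix moments\<close>

definition partitions :: "nat \<Rightarrow> nat \<Rightarrow> nat set set set" where
  "partitions n m = {p. partition_on {1..n} p \<and> card p = m}"

definition partitions_no_singleton :: "nat \<Rightarrow> nat \<Rightarrow> nat set set set" where
  "partitions_no_singleton n m = {p \<in> partitions n m. \<forall>B\<in>p. card B \<noteq> 1}"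

text \<open>The index (starting from 1) of the block containing \<open>i\<close>, when the blocks are listed by increasing
  smallest elements: it is the number of blocks whose smallest element does not exceed that of
  the block of \<open>i\<close>.\<close>

definition block_index :: "nat set set \<Rightarrow> nat \<Rightarrow> nat" where
  "block_index p i = card {B \<in> p. Min B \<le> Min (THE C. C \<in> p \<and> i \<in> C)}"

definition moment_part ::
    "'a measure \<Rightarrow> (nat \<Rightarrow> 'a \<Rightarrow> real ^ 'r ^ 'r) \<Rightarrow> (nat \<Rightarrow> real ^ 'r ^ 'r) \<Rightarrow> real ^ 'r ^ 'r
       \<Rightarrow> nat \<Rightarrow> nat set set \<Rightarrow> real ^ 'r ^ 'r" where
  "moment_part M Y Q P n p =
     (\<integral>\<omega>. mat_prod (\<lambda>i. Q i ** (Y (block_index p i) \<omega> - P)) n \<partial>M)"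

definition moment_part_circ ::
    "'a measure \<Rightarrow> (nat \<Rightarrow> 'a \<Rightarrow> real ^ 'r ^ 'r) \<Rightarrow> (nat \<Rightarrow> real ^ 'r ^ 'r)
       \<Rightarrow> nat \<Rightarrow> nat set set \<Rightarrow> real ^ 'r ^ 'r" where
  "moment_part_circ M Y Q n p =
     (\<integral>\<omega>. mat_prod (\<lambda>i. Q i ** Y (block_index p i) \<omega>) n \<partial>M)"

definition moment ::
    "'a measure \<Rightarrow> (nat \<Rightarrow> 'a \<Rightarrow> real ^ 'r ^ 'r) \<Rightarrow> (nat \<Rightarrow> real ^ 'r ^ 'r) \<Rightarrow> real ^ 'r ^ 'r
       \<Rightarrow> nat \<Rightarrow> nat \<Rightarrow> real ^ 'r ^ 'r" where
  "moment M Y Q P n m = (\<Sum>p\<in>partitions_no_singleton n m. moment_part M Y Q P n p)"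

definition moment_circ ::
    "'a measure \<Rightarrow> (nat \<Rightarrow> 'a \<Rightarrow> real ^ 'r ^ 'r) \<Rightarrow> (nat \<Rightarrow> real ^ 'r ^ 'r)
       \<Rightarrow> nat \<Rightarrow> nat \<Rightarrow> real ^ 'r ^ 'r" where
  "moment_circ M Y Q n m = (\<Sum>p\<in>partitions n m. moment_part_circ M Y Q n p)"


section \<open>Signed Stirling numbers and expansion coefficients\<close>

text \<open>The coefficients of the falling factorial \<open>x (x - 1) \<dots> (x - l + 1)\<close>. The library's
  \<^const>\<open>stirling\<close> is the unsigned version.\<close>

definition stirling_signed :: "nat \<Rightarrow> nat \<Rightarrow> int" where
  "stirling_signed l m = coeff (\<Prod>k<l. [:- int k, 1:]) m"

lemma stirling_signed_eq_stirling:
  "stirling_signed l m = (- 1) ^ (l + m) * int (stirling l m)"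
proof (induction l arbitrary: m)
  case 0
  show ?case by (cases m) (auto simp: stirling_signed_def)
next
  case (Suc l)
  have zero: "stirling_signed (Suc l) 0 = - int l * stirling_signed l 0"
    by (simp add: stirling_signed_def coeff_pCons mult.commute[of _ "[:- int l, 1:]"])
  have step: "stirling_signed (Suc l) (Suc k) = - int l * stirling_signed l (Suc k) + stirling_signed l k" for k
    by (simp add: stirling_signed_def mult.commute[of _ "[:- int l, 1:]"])
  show ?case
  proof (cases m)
    case 0
    then show ?thesis using zero Suc.IH[of 0] by (cases l) simp_all
  next
    case (Suc k)
    then show ?thesis by (simp add: step Suc.IH algebra_simps)
  qed
qed

lemma falling_factorial_eq_sum_stirling_signed:
  fixes x :: int
  assumes "l \<ge> 1"
  shows "(\<Prod>k<l. (x - int k)) = (\<Sum>m=1..l. stirling_signed l m * x ^ m)"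
proof -
  let ?p = "\<Prod>k<l. [:- int k, 1:]"
  have deg: "degree ?p \<le> l"
    using degree_prod_sum_le[of "{..<l}" "\<lambda>k. [:- int k, 1:]"] by simp
  have zero: "stirling_signed l 0 = 0"
    using assms by (cases l) (simp_all add: stirling_signed_eq_stirling)
  have "(\<Prod>k<l. (x - int k)) = poly ?p x"
    by (simp add: poly_prod)
  also have "\<dots> = (\<Sum>m\<le>l. stirling_signed l m * x ^ m)"
    unfolding stirling_signed_def poly_altdef
    by (rule sum.mono_neutral_left) (use deg in \<open>auto simp: coeff_eq_0\<close>)
  also have "\<dots> = (\<Sum>m=1..l. stirling_signed l m * x ^ m)"
    by (rule sum.mono_neutral_right) (use zero in \<open>auto simp: not_le\<close>)
  finally show ?thesis .
qed

definition expansion_coeff ::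
    "'a measure \<Rightarrow> (nat \<Rightarrow> 'a \<Rightarrow> real ^ 'r ^ 'r) \<Rightarrow> (nat \<Rightarrow> real ^ 'r ^ 'r) \<Rightarrow> real ^ 'r ^ 'r
       \<Rightarrow> nat \<Rightarrow> nat \<Rightarrow> real ^ 'r ^ 'r" where
  "expansion_coeff M Y Q P n m =
     (\<Sum>l=m..n div 2. real_of_int (stirling_signed l m) *\<^sub>R moment M Y Q P n l)"

definition expansion_coeff_circ ::
    "'a measure \<Rightarrow> (nat \<Rightarrow> 'a \<Rightarrow> real ^ 'r ^ 'r) \<Rightarrow> (nat \<Rightarrow> real ^ 'r ^ 'r)
       \<Rightarrow> nat \<Rightarrow> nat \<Rightarrow> real ^ 'r ^ 'r" where
  "expansion_coeff_circ M Y Q n m =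
     (\<Sum>l=m..n. real_of_int (stirling_signed l m) *\<^sub>R moment_circ M Y Q n l)"

end

theory Submission
  imports Defs
begin

text \<open>Both expansions come from one identity for i.i.d. random matrices \<open>Z j\<close> with all moments.
  Expanding \<open>\<Prod>i. Q i ** (\<Sum>j. Z j)\<close> by multilinearity gives a sum over maps
  \<open>{1..n} \<rightarrow> {1..N}\<close>. The expectation of a term depends only on the partition of \<open>{1..n}\<close> into the
  fibres of the map, and a partition with \<open>l\<close> blocks arises from \<open>N (N - 1) \<dots> (N - l + 1)\<close> maps; the
  Stirling numbers expand this falling factorial in powers of \<open>N\<close>. For the fluctuations the
  summands \<open>Y j - P\<close> are centered, so partitions with a singleton contribute nothing and at most
  \<open>n div 2\<close> blocks remain.\<close>

section \<open>Random vectors with all moments\<close>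

text \<open>Requiring every power at once makes the class closed under products, so that matrix
  products of any length are integrable without tracking exponents. Measurability is part of the
  definition, so that domination by such a function gives integrability.\<close>

definition has_moments :: "'a measure \<Rightarrow> ('a \<Rightarrow> 'b::euclidean_space) \<Rightarrow> bool" where
  "has_moments M f \<longleftrightarrow> f \<in> borel_measurable M \<and> (\<forall>k::nat. integrable M (\<lambda>\<omega>. norm (f \<omega>) ^ k))"

lemma has_moments_measurable [measurable_dest]: "has_moments M f \<Longrightarrow> f \<in> borel_measurable M"
  by (simp add: has_moments_def)

lemma has_moments_integrable:
  assumes "has_moments M f"
  shows "integrable M f"
proof -
  have "integrable M (\<lambda>\<omega>. norm (f \<omega>) ^ 1)"
    using assms unfolding has_moments_def by blast
  then show ?thesis
    using has_moments_measurable[OF assms] by (simp add: integrable_norm_iff)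
qed

lemma has_moments_bound:
  assumes "has_moments M f" and [measurable]: "g \<in> borel_measurable M"
    and "\<And>\<omega>. norm (g \<omega>) \<le> norm (f \<omega>)"
  shows "has_moments M g"
  unfolding has_moments_def
proof (intro conjI allI)
  fix k :: nat
  have "integrable M (\<lambda>\<omega>. norm (f \<omega>) ^ k)"
    using assms(1) by (simp add: has_moments_def)
  then show "integrable M (\<lambda>\<omega>. norm (g \<omega>) ^ k)"
    by (rule Bochner_Integration.integrable_bound) (auto intro!: AE_I2 power_mono assms(3))
qed fact

lemma has_moments_norm: "has_moments M f \<Longrightarrow> has_moments M (\<lambda>\<omega>. norm (f \<omega>))"
  by (auto simp: has_moments_def)

text \<open>Having moments is a property of the law alone. This transfers it from
  \<open>normal_law\<close> to the coordinates of a Gaussian vector, and from the outer square to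
  its copies.\<close>

lemma has_moments_distr:
  assumes "f \<in> borel_measurable M"
  shows "has_moments (distr M borel f) (\<lambda>x. x) \<longleftrightarrow> has_moments M f"
  using assms by (simp add: has_moments_def integrable_distr_eq)

context prob_space
begin

lemma has_moments_const: "has_moments M (\<lambda>_. c)"
  by (simp add: has_moments_def)

text \<open>With a = |f|^k and b = |g|^k, the bound ab \<le> a^2 + b^2 dominates the k-th power of
  the product by powers of order 2k of the factors.\<close>

lemma has_moments_mult:
  fixes f g :: "'a \<Rightarrow> real"
  assumes f: "has_moments M f" and g: "has_moments M g"
  shows "has_moments M (\<lambda>\<omega>. f \<omega> * g \<omega>)"
  unfolding has_moments_def
proof (intro conjI allI)
  note [measurable] = has_moments_measurable[OF f] has_moments_measurable[OF g]
  show "(\<lambda>\<omega>. f \<omega> * g \<omega>) \<in> borel_measurable M" by measurable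
  fix k :: nat
  have "integrable M (\<lambda>\<omega>. norm (f \<omega>) ^ (2 * k) + norm (g \<omega>) ^ (2 * k))"
    using f g by (auto simp only: has_moments_def intro!: Bochner_Integration.integrable_add)
  then show "integrable M (\<lambda>\<omega>. norm (f \<omega> * g \<omega>) ^ k)"
  proof (rule Bochner_Integration.integrable_bound)
    show "AE \<omega> in M. norm (norm (f \<omega> * g \<omega>) ^ k) \<le> norm (norm (f \<omega>) ^ (2 * k) + norm (g \<omega>) ^ (2 * k))"
    proof (rule AE_I2)
      fix \<omega>
      let ?a = "\<bar>f \<omega>\<bar> ^ k" and ?b = "\<bar>g \<omega>\<bar> ^ k"
      have "0 \<le> ?a * ?b" by simp
      then have "?a * ?b \<le> ?a\<^sup>2 + ?b\<^sup>2"
        using sum_squares_bound[of ?a ?b] by linarith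
      then show "norm (norm (f \<omega> * g \<omega>) ^ k) \<le> norm (norm (f \<omega>) ^ (2 * k) + norm (g \<omega>) ^ (2 * k))"
        by (simp add: abs_mult power_mult_distrib power_mult[symmetric] mult.commute[of k])
    qed
  qed measurable
qed

text \<open>The norm is dominated by a constant times the product of the two norms, which reduces
  the claim to real products; measurability comes from joint continuity. The instances used are
  scalar multiplication and matrix multiplication.\<close>

lemma has_moments_bounded_bilinear:
  assumes "bounded_bilinear b" and f: "has_moments M f" and g: "has_moments M g"
  shows "has_moments M (\<lambda>\<omega>. b (f \<omega>) (g \<omega>))"
proof -
  interpret bounded_bilinear b by fact
  note [measurable] = has_moments_measurable[OF f] has_moments_measurable[OF g]
  obtain K where K: "0 < K" "\<And>x y. norm (b x y) \<le> norm x * norm y * K"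
    using pos_bounded by blast
  have "has_moments M (\<lambda>\<omega>. norm (f \<omega>) * norm (g \<omega>) * K)"
    by (intro has_moments_mult has_moments_norm has_moments_const f g)
  then show ?thesis
  proof (rule has_moments_bound)
    show "norm (b (f \<omega>) (g \<omega>)) \<le> norm (norm (f \<omega>) * norm (g \<omega>) * K)" for \<omega>
      using K by (simp add: abs_mult)
    show "(\<lambda>\<omega>. b (f \<omega>) (g \<omega>)) \<in> borel_measurable M"
      by (rule borel_measurable_continuous_Pair)
        (auto intro!: continuous_on continuous_on_fst continuous_on_snd continuous_on_id)
  qed
qed

text \<open>The norm of the sum is at most twice the larger of the two norms, and the k-th power of
  a maximum is at most the sum of the k-th powers.\<close>

lemma has_moments_add:
  assumes f: "has_moments M f" and g: "has_moments M g"
  shows "has_moments M (\<lambda>\<omega>. f \<omega> + g \<omega>)"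
  unfolding has_moments_def
proof (intro conjI allI)
  note [measurable] = has_moments_measurable[OF f] has_moments_measurable[OF g]
  show "(\<lambda>\<omega>. f \<omega> + g \<omega>) \<in> borel_measurable M" by measurable
  fix k :: nat
  have "integrable M (\<lambda>\<omega>. 2 ^ k * (norm (f \<omega>) ^ k + norm (g \<omega>) ^ k))"
    using f g by (auto simp only: has_moments_def
      intro!: Bochner_Integration.integrable_add integrable_mult_right)
  then show "integrable M (\<lambda>\<omega>. norm (f \<omega> + g \<omega>) ^ k)"
  proof (rule Bochner_Integration.integrable_bound)
    show "AE \<omega> in M. norm (norm (f \<omega> + g \<omega>) ^ k) \<le> norm (2 ^ k * (norm (f \<omega>) ^ k + norm (g \<omega>) ^ k))"
    proof (rule AE_I2)
      fix \<omega>
      let ?m = "max (norm (f \<omega>)) (norm (g \<omega>))"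
      have "norm (f \<omega> + g \<omega>) \<le> 2 * ?m"
        using norm_triangle_ineq[of "f \<omega>" "g \<omega>"] by simp
      then have "norm (f \<omega> + g \<omega>) ^ k \<le> 2 ^ k * ?m ^ k"
        using power_mono[of "norm (f \<omega> + g \<omega>)" "2 * ?m" k] by (simp add: power_mult_distrib)
      also have "\<dots> \<le> 2 ^ k * (norm (f \<omega>) ^ k + norm (g \<omega>) ^ k)"
        by (intro mult_left_mono) (auto simp: max_def)
      finally show "norm (norm (f \<omega> + g \<omega>) ^ k) \<le> norm (2 ^ k * (norm (f \<omega>) ^ k + norm (g \<omega>) ^ k))"
        by simp
    qed
  qed measurable
qed

lemma has_moments_sum:
  "(\<And>i. i \<in> I \<Longrightarrow> has_moments M (f i)) \<Longrightarrow> has_moments M (\<lambda>\<omega>. \<Sum>i\<in>I. f i \<omega>)"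
  by (induction I rule: infinite_finite_induct)
    (auto intro!: has_moments_const has_moments_add)

lemma has_moments_inner_Basis:
  assumes "\<And>b. b \<in> Basis \<Longrightarrow> has_moments M (\<lambda>\<omega>. f \<omega> \<bullet> b)"
  shows "has_moments M f"
proof -
  have "has_moments M (\<lambda>\<omega>. \<Sum>b\<in>Basis. (f \<omega> \<bullet> b) *\<^sub>R b)"
    by (intro has_moments_sum has_moments_bounded_bilinear[OF bounded_bilinear_scaleR]
      assms has_moments_const)
  then show ?thesis by (simp add: euclidean_representation)
qed

end

section \<open>Gaussian vectors\<close>

text \<open>For \<open>v = 0\<close> the identity is almost surely the constant \<mu>. Otherwise the
  absolute central moments are finite, and adding the constant \<mu> back preserves the
  class.\<close>

lemma has_moments_normal_law:
  assumes "0 \<le> v"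
  shows "has_moments (normal_law \<mu> v) (\<lambda>x. x)"
proof (cases "v = 0")
  case True
  then interpret prob_space "normal_law \<mu> v"
    by (simp add: normal_law_def prob_space_return)
  have law: "normal_law \<mu> v = return borel \<mu>"
    using True by (simp add: normal_law_def)
  have "integrable (normal_law \<mu> v) (\<lambda>x. norm x ^ k)" for k :: nat
  proof (rule integrable_cong_AE_imp)
    show "integrable (normal_law \<mu> v) (\<lambda>_. norm \<mu> ^ k)"
      by (rule integrable_const)
    show "AE x in normal_law \<mu> v. norm \<mu> ^ k = norm x ^ k"
      unfolding law by (subst AE_return) auto
  qed (simp add: law)
  then show ?thesis using True by (simp add: has_moments_def normal_law_def)
next
  case False
  with assms have v: "0 < sqrt v" by simp
  from v interpret prob_space "normal_law \<mu> v"
    using False by (simp add: normal_law_def prob_space_normal_density)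
  have "has_moments (normal_law \<mu> v) (\<lambda>x. x - \<mu>)"
    using False integrable_normal_moment_abs[of "sqrt v" \<mu>] v
    by (auto simp: has_moments_def normal_law_def integrable_real_density)
  from has_moments_add[OF this has_moments_const[of \<mu>]] show ?thesis by simp
qed

lemma gaussian_vector_component_has_moments:
  fixes X :: "'a \<Rightarrow> real ^ 'r"
  assumes "gaussian_vector M X"
  shows "has_moments M (\<lambda>\<omega>. X \<omega> $ i)"
proof -
  \<comment> \<open>The i-th coordinate is the projection onto the i-th unit vector, one of the
    directions in which the law is normal.\<close>
  obtain \<mu> v where v: "0 \<le> v" "distr M borel (\<lambda>\<omega>. axis i 1 \<bullet> X \<omega>) = normal_law \<mu> v"
    using assms unfolding gaussian_vector_def by blast
  have [measurable]: "X \<in> borel_measurable M"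
    using assms by (simp add: gaussian_vector_def)
  have "has_moments M (\<lambda>\<omega>. axis i 1 \<bullet> X \<omega>)"
    using has_moments_normal_law[OF v(1), of \<mu>] has_moments_distr[of "\<lambda>\<omega>. axis i 1 \<bullet> X \<omega>" M]
    by (simp flip: v(2))
  then show ?thesis by (simp add: inner_axis inner_commute)
qed

lemma (in prob_space) gaussian_vector_has_moments:
  fixes X :: "'a \<Rightarrow> real ^ 'r"
  assumes "gaussian_vector M X"
  shows "has_moments M X"
  by (rule has_moments_inner_Basis)
    (auto simp: Basis_vec_def inner_axis gaussian_vector_component_has_moments[OF assms])

lemma (in prob_space) outer_square_has_moments:
  assumes "gaussian_vector M X"
  shows "has_moments M (\<lambda>\<omega>. outer_square (X \<omega>))"
  by (rule has_moments_inner_Basis)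
    (auto simp: Basis_vec_def inner_axis outer_square_def
      intro!: has_moments_mult gaussian_vector_component_has_moments[OF assms])

text \<open>Reading off an entry is bounded linear and so commutes with the integral; since the mean
  is zero, the entries are those of the covariance matrix.\<close>

lemma (in prob_space) expectation_outer_square:
  assumes X: "gaussian_vector M X" and mean: "(\<integral>\<omega>. X \<omega> \<partial>M) = 0"
  shows "(\<integral>\<omega>. outer_square (X \<omega>) \<partial>M) = covariance_matrix M X"
proof -
  note intX = has_moments_integrable[OF gaussian_vector_has_moments[OF X]]
  have zero: "(\<integral>\<omega>. X \<omega> $ i \<partial>M) = 0" for i
    using integral_bounded_linear[OF bounded_linear_vec_nth intX, of i] mean by simp
  note intS = has_moments_integrable[OF outer_square_has_moments[OF X]]
  have "bounded_linear (\<lambda>A::real^'b^'b. A $ i $ j)" for i j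
    by (rule bounded_linear_compose[OF bounded_linear_vec_nth bounded_linear_vec_nth])
  from integral_bounded_linear[OF this intS] show ?thesis
    by (simp add: vec_eq_iff covariance_matrix_def zero) (simp add: outer_square_def)
qed

section \<open>Products of matrices\<close>

lemma bounded_bilinear_matrix_mult:
  "bounded_bilinear ((**) :: real ^ 'm ^ 'n \<Rightarrow> real ^ 'p ^ 'm \<Rightarrow> real ^ 'p ^ 'n)"
  unfolding bilinear_conv_bounded_bilinear[symmetric] bilinear_def
  by (auto intro!: linearI simp: vec_eq_iff matrix_matrix_mult_def algebra_simps sum.distrib
    sum_distrib_left)

lemma mat_prod_cong: "(\<And>i. i \<in> {1..n} \<Longrightarrow> A i = B i) \<Longrightarrow> mat_prod A n = mat_prod B n"
  by (induction n) auto

lemma mat_prod_scaleR: "mat_prod (\<lambda>i. c *\<^sub>R A i) n = c ^ n *\<^sub>R mat_prod A n"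
  by (induction n) (simp_all add: bounded_bilinear.scaleR_left[OF bounded_bilinear_matrix_mult]
    bounded_bilinear.scaleR_right[OF bounded_bilinear_matrix_mult])

text \<open>An ordered product is linear in each single factor. This lets the expectation pass into
  one random factor while the others are frozen.\<close>

lemma bounded_linear_mat_prod:
  assumes "k \<in> {1..n}" "bounded_linear L"
  shows "bounded_linear (\<lambda>y. mat_prod (A(k := L y)) n)"
  using assms(1)
proof (induction n)
  case (Suc n)
  show ?case
  proof (cases "k = Suc n")
    case True
    then have "mat_prod (A(k := L y)) n = mat_prod A n" for y
      by (intro mat_prod_cong) auto
    with True show ?thesis
      by (simp del: fun_upd_apply add: fun_upd_same bounded_linear_compose[OF
        bounded_bilinear.bounded_linear_right[OF bounded_bilinear_matrix_mult] assms(2)])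
  next
    case False
    then have "k \<in> {1..n}"
      using Suc.prems by auto
    from bounded_linear_compose[OF
        bounded_bilinear.bounded_linear_left[OF bounded_bilinear_matrix_mult] Suc.IH[OF this]] False
    show ?thesis by (simp del: fun_upd_apply add: fun_upd_other)
  qed
qed simp

text \<open>Multilinearity, by induction on the length: an extensional map on
  \<open>{1..Suc n}\<close> is a map on \<open>{1..n}\<close> together with its value at
  \<open>Suc n\<close>.\<close>

lemma mat_prod_sum:
  assumes "finite J"
  shows "mat_prod (\<lambda>i. \<Sum>j\<in>J. A i j) n = (\<Sum>a \<in> {1..n} \<rightarrow>\<^sub>E J. mat_prod (\<lambda>i. A i (a i)) n)"
proof (induction n)
  case (Suc n)
  note [simp] = bounded_bilinear.sum_left[OF bounded_bilinear_matrix_mult]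
    bounded_bilinear.sum_right[OF bounded_bilinear_matrix_mult]
  have eq: "mat_prod (\<lambda>i. A i ((a(Suc n := j)) i)) n = mat_prod (\<lambda>i. A i (a i)) n" for a j
    by (rule mat_prod_cong) auto
  have "(\<Sum>a \<in> {1..Suc n} \<rightarrow>\<^sub>E J. mat_prod (\<lambda>i. A i (a i)) (Suc n)) =
      (\<Sum>(j, a) \<in> J \<times> ({1..n} \<rightarrow>\<^sub>E J). mat_prod (\<lambda>i. A i ((a(Suc n := j)) i)) (Suc n))"
    unfolding atLeastAtMostSuc_conv[OF le_SucI, OF le0, of n] PiE_insert_eq
      atLeastAtMostSuc_conv[of 1 n, simplified] One_nat_def
    by (subst sum.reindex[OF inj_combinator]) (auto simp: case_prod_unfold)
  also have "\<dots> = (\<Sum>j\<in>J. \<Sum>a \<in> {1..n} \<rightarrow>\<^sub>E J. mat_prod (\<lambda>i. A i (a i)) n ** A (Suc n) j)"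
    by (simp add: sum.cartesian_product eq del: fun_upd_apply) simp
  also have "\<dots> = mat_prod (\<lambda>i. \<Sum>j\<in>J. A i j) (Suc n)"
    by (simp add: Suc.IH sum.swap[of _ J])
  finally show ?case by simp
qed simp

lemma (in prob_space) has_moments_mat_prod:
  assumes "\<And>i. i \<in> {1..n} \<Longrightarrow> has_moments M (A i)"
  shows "has_moments M (\<lambda>\<omega>. mat_prod (\<lambda>i. A i \<omega>) n)"
  using assms by (induction n)
    (auto intro!: has_moments_const has_moments_bounded_bilinear[OF bounded_bilinear_matrix_mult])

lemma borel_measurable_matrix_mult [measurable (raw)]:
  fixes A :: "'a \<Rightarrow> real ^ 'm ^ 'n" and B :: "'a \<Rightarrow> real ^ 'p ^ 'm"
  assumes "A \<in> borel_measurable M" "B \<in> borel_measurable M"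
  shows "(\<lambda>\<omega>. A \<omega> ** B \<omega>) \<in> borel_measurable M"
  using assms by (rule borel_measurable_continuous_Pair)
    (auto intro!: bounded_bilinear.continuous_on[OF bounded_bilinear_matrix_mult]
      continuous_on_fst continuous_on_snd continuous_on_id)

lemma borel_measurable_mat_prod:
  assumes "\<And>i. i \<in> {1..n} \<Longrightarrow> A i \<in> borel_measurable M"
  shows "(\<lambda>\<omega>. mat_prod (\<lambda>i. A i \<omega>) n) \<in> borel_measurable M"
  using assms by (induction n) (auto intro!: borel_measurable_matrix_mult)

section \<open>Partitions and kernels of maps\<close>

definition kernel_partition :: "'a set \<Rightarrow> ('a \<Rightarrow> 'b) \<Rightarrow> 'a set set" where
  "kernel_partition S a = (\<lambda>x. {i \<in> S. a i = x}) ` a ` S"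

lemma partition_on_kernel_partition: "partition_on S (kernel_partition S a)"
  by (auto simp: partition_on_def kernel_partition_def disjoint_def)

lemma kernel_partition_same_block:
  assumes "i \<in> S" "j \<in> S"
  shows "a i = a j \<longleftrightarrow> (\<exists>B\<in>kernel_partition S a. i \<in> B \<and> j \<in> B)"
  using assms by (auto simp: kernel_partition_def)

lemma partition_on_ex1_block:
  assumes "partition_on S p" "i \<in> S"
  shows "\<exists>!B. B \<in> p \<and> i \<in> B"
proof -
  obtain B where "B \<in> p" "i \<in> B"
    using assms by (auto simp: partition_on_def)
  moreover have "C = B" if "C \<in> p" "i \<in> C" for C
    using that calculation partition_onD2[OF assms(1)] disjointD[of p B C] by auto
  ultimately show ?thesis by blast
qed

text \<open>Maps with kernel \<open>p\<close> correspond to injections defined on the set of blocks \<open>p\<close>.\<close>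

lemma card_maps_with_kernel:
  assumes "finite S" "finite J" "partition_on S p"
  shows "card {a \<in> S \<rightarrow>\<^sub>E J. kernel_partition S a = p} = (\<Prod>k<card p. card J - k)"
proof -
  have fin: "finite p" using finite_elements[OF assms(1,3)] .
  have ne: "\<exists>i. i \<in> B" "B \<subseteq> S" if "B \<in> p" for B
    using that assms(3) by (auto simp only: partition_on_def ex_in_conv)
  have blk: "\<exists>!B. B \<in> p \<and> i \<in> B" if "i \<in> S" for i
    using partition_on_ex1_block[OF assms(3) that] .
  define blk where "blk i = (THE B. B \<in> p \<and> i \<in> B)" for i
  have blk_in: "blk i \<in> p" "i \<in> blk i" if "i \<in> S" for i
    using theI'[OF blk[OF that]] by (auto simp: blk_def)
  have blk_eq: "blk i = B" if "B \<in> p" "i \<in> B" for i B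
    unfolding blk_def using that blk[of i] ne[of B] by (intro the_equality) auto
  \<comment> \<open>An injection on blocks is composed with the map sending a point to its block;
    the restriction to \<open>S\<close> makes the result extensional.\<close>
  define \<Phi> where "\<Phi> s = (\<lambda>i\<in>S. s (blk i))" for s :: "'a set \<Rightarrow> 'b"
  have "bij_betw \<Phi> {s \<in> p \<rightarrow>\<^sub>E J. inj_on s p} {a \<in> S \<rightarrow>\<^sub>E J. kernel_partition S a = p}"
  proof (rule bij_betw_imageI)
    show "inj_on \<Phi> {s \<in> p \<rightarrow>\<^sub>E J. inj_on s p}"
    proof (intro inj_onI, elim CollectE conjE)
      fix s t assume st: "s \<in> p \<rightarrow>\<^sub>E J" "t \<in> p \<rightarrow>\<^sub>E J" "\<Phi> s = \<Phi> t"
      have "s B = t B" if B: "B \<in> p" for B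
      proof -
        obtain i where i: "i \<in> B" "i \<in> S" using ne[OF B] by blast
        then show ?thesis
          using fun_cong[OF st(3), of i] blk_eq[OF B i(1)] by (simp add: \<Phi>_def)
      qed
      with st show "s = t" by (intro PiE_ext) auto
    qed
    show "\<Phi> ` {s \<in> p \<rightarrow>\<^sub>E J. inj_on s p} = {a \<in> S \<rightarrow>\<^sub>E J. kernel_partition S a = p}"
    proof (intro set_eqI iffI; elim imageE CollectE conjE)
      fix a s assume s: "a = \<Phi> s" "s \<in> p \<rightarrow>\<^sub>E J" "inj_on s p"
      \<comment> \<open>Because \<open>s\<close> is injective on blocks, points have equal values
        exactly when they lie in the same block.\<close>
      have fib: "{j \<in> S. a j = a i} = blk i" if "i \<in> S" for i
      proof -
        have "j \<in> S \<and> a j = a i \<longleftrightarrow> j \<in> blk i" for j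
          using s(3)[THEN inj_on_eq_iff, OF blk_in(1) blk_in(1), of j i] that blk_in[of j]
            blk_in[OF that] blk_eq[OF blk_in(1)[OF that], of j] ne[OF blk_in(1)[OF that]]
          by (auto simp: s(1) \<Phi>_def)
        then show ?thesis by blast
      qed
      have "kernel_partition S a = blk ` S"
        using fib by (auto simp: kernel_partition_def image_image)
      also have "\<dots> = p"
        using blk_in(1) blk_eq ne by (force simp: image_iff)
      finally show "a \<in> {a \<in> S \<rightarrow>\<^sub>E J. kernel_partition S a = p}"
        using s blk_in(1) by (auto simp: \<Phi>_def)
    next
      fix a assume a: "a \<in> S \<rightarrow>\<^sub>E J" "kernel_partition S a = p"
      \<comment> \<open>The inverse evaluates \<open>a\<close> at an arbitrary representative of the
        block; \<open>s_eq\<close> shows that the choice does not matter, since \<open>a\<close> is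
        constant on each block.\<close>
      define s where "s = (\<lambda>B\<in>p. a (SOME i. i \<in> B))"
      have some: "(SOME i. i \<in> B) \<in> B" if "B \<in> p" for B
        using ne(1)[OF that] by (rule someI_ex)
      have s_eq: "s B = a i" if "B \<in> p" "i \<in> B" for B i
      proof -
        have "(SOME i. i \<in> B) \<in> S" "i \<in> S" using some ne(2) that by blast+
        then show ?thesis
          using kernel_partition_same_block[of "SOME i. i \<in> B" S i a] some that
          by (auto simp: s_def a(2))
      qed
      have "s \<in> p \<rightarrow>\<^sub>E J"
        using some ne(2) a(1) by (fastforce simp: s_def)
      moreover have "inj_on s p"
      proof (rule inj_onI)
        fix B C assume BC: "B \<in> p" "C \<in> p" "s B = s C"
        then obtain i j where ij: "i \<in> B" "j \<in> C" using ne(1) by blast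
        then have "a i = a j" using s_eq BC by metis
        then obtain D where "D \<in> p" "i \<in> D" "j \<in> D"
          using kernel_partition_same_block[of i S j a] ij BC ne(2) a(2) by blast
        then show "B = C" using blk_eq BC ij by metis
      qed
      moreover have "a = \<Phi> s"
      proof
        fix i show "a i = \<Phi> s i"
          using a(1) s_eq[OF blk_in, of i] by (cases "i \<in> S") (auto simp: \<Phi>_def PiE_def extensional_def)
      qed
      ultimately show "a \<in> \<Phi> ` {s \<in> p \<rightarrow>\<^sub>E J. inj_on s p}" by blast
    qed
  qed
  then have "card {a \<in> S \<rightarrow>\<^sub>E J. kernel_partition S a = p} = card {s \<in> p \<rightarrow>\<^sub>E J. inj_on s p}"
    by (simp add: bij_betw_same_card)
  also have "\<dots> = (\<Prod>k<card p. card J - k)"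
    using card_inj_on_subset_funcset[OF fin assms(2) subset_refl] by (simp add: atLeast0LessThan)
  finally show ?thesis .
qed

text \<open>Truncated subtraction does no harm: if \<open>l\<close> exceeds \<open>N\<close>, both
  products contain a zero factor at \<open>k = N\<close>, in accordance with the absence of
  injections.\<close>

lemma of_nat_prod_diff:
  "real (\<Prod>k<l. N - k) = (\<Prod>k<l. real N - real k)"
proof (cases "l \<le> N")
  case True
  then show ?thesis by (auto simp: of_nat_diff intro!: prod.cong)
next
  case False
  then have "N \<in> {..<l}" by simp
  then have "(\<Prod>k<l. N - k) = 0" "(\<Prod>k<l. real N - real k) = 0"
    by (auto intro!: prod_zero bexI[of _ N])
  then show ?thesis by (simp only: of_nat_0)
qed

text \<open>The index is strictly increasing in the smallest element of the block, and disjoint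
  blocks have different smallest elements, so distinct blocks receive distinct indices.\<close>

lemma block_index_eq_iff:
  assumes p: "partition_on {1..n} p" and i: "i \<in> {1..n}" and j: "j \<in> {1..n}"
  shows "block_index p i = block_index p j \<longleftrightarrow> (\<exists>B\<in>p. i \<in> B \<and> j \<in> B)"
proof -
  have fin: "finite p" using finite_elements[OF _ p] by simp
  have finB: "finite B" "B \<noteq> {}" if "B \<in> p" for B
    using that p finite_subset[of B "{1..n}"] by (auto simp only: partition_on_def)
  have blk: "\<exists>!B. B \<in> p \<and> i \<in> B" if "i \<in> {1..n}" for i
    using partition_on_ex1_block[OF p that] .
  obtain B C where B: "B \<in> p" "i \<in> B" and C: "C \<in> p" "j \<in> C"
    using blk i j by metis
  have the: "(THE D. D \<in> p \<and> i \<in> D) = B" "(THE D. D \<in> p \<and> j \<in> D) = C"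
    using B C blk i j by (auto intro!: the1_equality)
  \<comment> \<open>Raising the threshold from \<open>Min B\<close> to \<open>Min C\<close> adds at
    least the block \<open>C\<close> itself.\<close>
  have lt: "card {D \<in> p. Min D \<le> Min B} < card {D \<in> p. Min D \<le> Min C}"
    if "Min B < Min C" "C \<in> p" for B C
  proof (rule psubset_card_mono)
    have "C \<in> {D \<in> p. Min D \<le> Min C} - {D \<in> p. Min D \<le> Min B}"
      using that by auto
    moreover have "{D \<in> p. Min D \<le> Min B} \<subseteq> {D \<in> p. Min D \<le> Min C}"
      using that by auto
    ultimately show "{D \<in> p. Min D \<le> Min B} \<subset> {D \<in> p. Min D \<le> Min C}"
      by blast
  qed (simp add: fin)
  have "block_index p i = block_index p j \<longleftrightarrow> Min B = Min C"
    unfolding block_index_def the using lt[of B C] lt[of C B] B C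
    by (cases "Min B" "Min C" rule: linorder_cases) auto
  also have "\<dots> \<longleftrightarrow> B = C"
  proof
    assume "Min B = Min C"
    then have "Min B \<in> B \<inter> C"
      using Min_in[OF finB[OF B(1)]] Min_in[OF finB[OF C(1)]] by simp
    then show "B = C"
      using B C partition_onD2[OF p] by (auto simp: disjoint_def)
  qed simp
  also have "\<dots> \<longleftrightarrow> (\<exists>B\<in>p. i \<in> B \<and> j \<in> B)"
    using B C blk[OF i] blk[OF j] by blast
  finally show ?thesis .
qed

text \<open>The block of \<open>i\<close> is among the blocks counted. Positivity keeps the indices
  in \<open>{1..}\<close>, where the matrices are independent with a common law.\<close>

lemma block_index_pos:
  assumes p: "partition_on {1..n} p" and i: "i \<in> {1..n}"
  shows "block_index p i \<ge> 1"
proof -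
  have blk: "\<exists>!B. B \<in> p \<and> i \<in> B"
    using partition_on_ex1_block[OF p i] .
  have "(THE C. C \<in> p \<and> i \<in> C) \<in> p"
    using theI'[OF blk] by blast
  then have "{B \<in> p. Min B \<le> Min (THE C. C \<in> p \<and> i \<in> C)} \<noteq> {}"
    by blast
  moreover have "finite p" using finite_elements[OF _ p] by simp
  ultimately show ?thesis
    by (simp add: block_index_def Suc_le_eq card_gt_0_iff)
qed

text \<open>The block sizes add up to \<open>card S\<close> and each is at least 1, or at least 2
  without singletons. The last bound is the source of \<open>n div 2\<close>.\<close>

lemma partition_on_bounds:
  assumes "partition_on S p" "finite S"
  shows "card p \<le> card S" "S \<noteq> {} \<Longrightarrow> 1 \<le> card p"
    "(\<And>B. B \<in> p \<Longrightarrow> card B \<noteq> 1) \<Longrightarrow> 2 * card p \<le> card S"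
proof -
  have fin: "finite p" using finite_elements assms by blast
  have finB: "finite B" "B \<noteq> {}" if "B \<in> p" for B
    using that partition_onD1[OF assms(1)] partition_onD3[OF assms(1)] finite_subset[OF _ assms(2)] by auto
  have eq: "card S = (\<Sum>B\<in>p. card B)"
    using assms(1) finB by (auto simp: partition_on_def intro!: card_Union_disjoint)
  have pos: "card B \<ge> 1" if "B \<in> p" for B
    using finB[OF that] by (simp add: Suc_le_eq card_gt_0_iff)
  show "card p \<le> card S"
    using sum_mono[of p "\<lambda>_. 1" card] pos eq by simp
  show "1 \<le> card p" if "S \<noteq> {}"
    using that assms(1) fin by (auto simp: partition_on_def Suc_le_eq card_gt_0_iff)
  show "2 * card p \<le> card S" if "\<And>B. B \<in> p \<Longrightarrow> card B \<noteq> 1"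
  proof -
    have "card B \<ge> 2" if "B \<in> p" for B
      using pos[OF that] \<open>\<And>B. B \<in> p \<Longrightarrow> card B \<noteq> 1\<close>[OF that] by simp
    then show ?thesis
      using sum_mono[of p "\<lambda>_. 2" card] eq by (simp add: mult.commute)
  qed
qed

lemma finite_partitions: "finite (partitions n m)"
  unfolding partitions_def
  by (rule finite_subset[OF _ finitely_many_partition_on[of "{1..n}"]]) auto

section \<open>Independent identically distributed matrices\<close>

context prob_space
begin

text \<open>Independence on \<sigma>(J) gives a product law there, and a product of equal factors is
  carried to a product over \<open>J\<close> by the injective relabelling \<sigma>.\<close>

lemma distr_iid_eq_PiM:
  assumes ind: "indep_vars (\<lambda>_. borel) Z I" and D: "\<And>i. i \<in> I \<Longrightarrow> distr M borel (Z i) = D"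
    and \<sigma>: "inj_on \<sigma> J" "\<sigma> ` J \<subseteq> I" and "J \<noteq> {}"
  shows "distr M (PiM J (\<lambda>_. borel)) (\<lambda>\<omega>. \<lambda>j\<in>J. Z (\<sigma> j) \<omega>) = PiM J (\<lambda>_. D)"
proof -
  let ?K = "\<sigma> ` J"
  have rv: "Z i \<in> borel_measurable M" if "i \<in> I" for i
    using ind that by (auto simp: indep_vars_def)
  have "?K \<noteq> {}" using \<open>J \<noteq> {}\<close> by simp
  then obtain i where i: "i \<in> I" using \<sigma> by blast
  have probD: "prob_space D"
    using prob_space_distr[OF rv[OF i]] D[OF i] by simp
  have setsD [measurable_cong]: "sets D = sets borel"
    using D[OF i] by (metis sets_distr)
  have "indep_vars (\<lambda>_. borel) Z ?K"
    using ind \<sigma>(2) by (rule indep_vars_subset)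
  then have K: "distr M (PiM ?K (\<lambda>_. borel)) (\<lambda>\<omega>. \<lambda>i\<in>?K. Z i \<omega>) = PiM ?K (\<lambda>i. distr M borel (Z i))"
    using \<sigma> rv \<open>?K \<noteq> {}\<close> by (subst (asm) indep_vars_iff_distr_eq_PiM') auto
  also have "\<dots> = PiM ?K (\<lambda>_. D)"
    using D \<sigma>(2) by (intro PiM_cong) auto
  finally have K: "PiM ?K (\<lambda>_. D) = distr M (PiM ?K (\<lambda>_. borel)) (\<lambda>\<omega>. \<lambda>i\<in>?K. Z i \<omega>)" ..
  have [measurable]: "(\<lambda>\<omega>. \<lambda>i\<in>?K. Z i \<omega>) \<in> measurable M (PiM ?K (\<lambda>_. borel))"
    using rv \<sigma>(2) by (intro measurable_restrict) auto
  have [measurable]: "(\<lambda>x. \<lambda>n\<in>J. x (\<sigma> n)) \<in> measurable (PiM ?K (\<lambda>_. borel)) (PiM J (\<lambda>_. borel))"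
    by (intro measurable_restrict measurable_component_singleton) auto
  have "PiM J (\<lambda>_. D) = distr (PiM ?K (\<lambda>_. D)) (PiM J (\<lambda>_. D)) (\<lambda>x. \<lambda>n\<in>J. x (\<sigma> n))"
    using probD \<sigma> by (subst distr_PiM_reindex) auto
  also have "\<dots> = distr (PiM ?K (\<lambda>_. D)) (PiM J (\<lambda>_. borel)) (\<lambda>x. \<lambda>n\<in>J. x (\<sigma> n))"
    by (intro distr_cong refl sets_PiM_cong setsD)
  also have "\<dots> = distr M (PiM J (\<lambda>_. borel)) (\<lambda>\<omega>. \<lambda>j\<in>J. Z (\<sigma> j) \<omega>)"
    unfolding K by (subst distr_distr) (auto simp: comp_def intro!: distr_cong)
  finally show ?thesis ..
qed

text \<open>Maps with the same kernel differ by an injective relabelling of values, which does not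
  affect the law of an i.i.d. family.\<close>

lemma distr_iid_eq_if_same_kernel:
  fixes Z :: "'i \<Rightarrow> 'a \<Rightarrow> 'b::topological_space"
  assumes ind: "indep_vars (\<lambda>_. borel) Z I" and D: "\<And>i. i \<in> I \<Longrightarrow> distr M borel (Z i) = D"
    and ab: "a ` S \<subseteq> I" "b ` S \<subseteq> I" "\<And>i j. i \<in> S \<Longrightarrow> j \<in> S \<Longrightarrow> a i = a j \<longleftrightarrow> b i = b j"
    and "S \<noteq> {}"
  shows "distr M (PiM S (\<lambda>_. borel)) (\<lambda>\<omega>. \<lambda>i\<in>S. Z (a i) \<omega>) =
    distr M (PiM S (\<lambda>_. borel)) (\<lambda>\<omega>. \<lambda>i\<in>S. Z (b i) \<omega>)"
proof -
  let ?J = "b ` S"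
  \<comment> \<open>Going back along \<open>b\<close> through any preimage gives a well-defined
    relabelling from \<open>b\<close> to \<open>a\<close>, because \<open>a\<close> is constant on
    the fibres of \<open>b\<close>; it is injective because the converse holds too.\<close>
  define \<sigma> where "\<sigma> = (\<lambda>j. a (inv_into S b j))"
  have \<sigma>: "\<sigma> (b i) = a i" if "i \<in> S" for i
    using that ab(3)[of "inv_into S b (b i)" i] by (simp add: \<sigma>_def inv_into_into f_inv_into_f)
  have inj: "inj_on \<sigma> ?J" and sub: "\<sigma> ` ?J \<subseteq> I"
    using ab \<sigma> by (auto simp: inj_on_def)
  have rv: "Z i \<in> borel_measurable M" if "i \<in> I" for i
    using ind that by (auto simp: indep_vars_def)
  \<comment> \<open>The right-hand side does not mention \<tau>, so the instances for \<sigma> and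
    for the identity have the same law.\<close>
  have lift: "distr M (PiM S (\<lambda>_. borel)) (\<lambda>\<omega>. \<lambda>i\<in>S. Z (\<tau> (b i)) \<omega>) =
      distr (PiM ?J (\<lambda>_. D)) (PiM S (\<lambda>_. borel)) (\<lambda>x. \<lambda>i\<in>S. x (b i))"
    if \<tau>: "inj_on \<tau> ?J" "\<tau> ` ?J \<subseteq> I" for \<tau>
  proof -
    have [measurable]: "(\<lambda>\<omega>. \<lambda>j\<in>?J. Z (\<tau> j) \<omega>) \<in> measurable M (PiM ?J (\<lambda>_. borel))"
      using rv \<tau>(2) by (intro measurable_restrict) auto
    have [measurable]: "(\<lambda>x. \<lambda>i\<in>S. x (b i)) \<in> measurable (PiM ?J (\<lambda>_. borel)) (PiM S (\<lambda>_. borel))"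
      by (intro measurable_restrict measurable_component_singleton) auto
    show ?thesis
      using \<open>S \<noteq> {}\<close>
      by (subst distr_iid_eq_PiM[OF ind D \<tau>, symmetric])
        (auto simp: distr_distr comp_def intro!: distr_cong)
  qed
  have "distr M (PiM S (\<lambda>_. borel)) (\<lambda>\<omega>. \<lambda>i\<in>S. Z (a i) \<omega>) =
      distr M (PiM S (\<lambda>_. borel)) (\<lambda>\<omega>. \<lambda>i\<in>S. Z (\<sigma> (b i)) \<omega>)"
    by (intro distr_cong refl restrict_ext) (simp add: \<sigma>)
  also have "\<dots> = distr M (PiM S (\<lambda>_. borel)) (\<lambda>\<omega>. \<lambda>i\<in>S. Z (b i) \<omega>)"
    using lift[OF inj sub] lift[of "\<lambda>j. j"] ab(2) by simp
  finally show ?thesis .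
qed

text \<open>The integrand is one measurable function of the matrices occupying the \<open>n\<close>
  positions, so only their joint law matters.\<close>

lemma expectation_mat_prod_eq_if_same_kernel:
  fixes Z :: "nat \<Rightarrow> 'a \<Rightarrow> real ^ 'r ^ 'r"
  assumes ind: "indep_vars (\<lambda>_. borel) Z I" and D: "\<And>i. i \<in> I \<Longrightarrow> distr M borel (Z i) = D"
    and ab: "a ` {1..n} \<subseteq> I" "b ` {1..n} \<subseteq> I"
      "\<And>i j. i \<in> {1..n} \<Longrightarrow> j \<in> {1..n} \<Longrightarrow> a i = a j \<longleftrightarrow> b i = b j"
    and "n \<ge> 1"
  shows "(\<integral>\<omega>. mat_prod (\<lambda>i. Q i ** Z (a i) \<omega>) n \<partial>M) = (\<integral>\<omega>. mat_prod (\<lambda>i. Q i ** Z (b i) \<omega>) n \<partial>M)"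
proof -
  let ?S = "{1..n}" and ?\<Pi> = "PiM {1..n} (\<lambda>_. borel :: (real ^ 'r ^ 'r) measure)"
  let ?G = "\<lambda>x. mat_prod (\<lambda>i. Q i ** x i) n"
  have G: "?G \<in> borel_measurable ?\<Pi>"
    by (intro borel_measurable_mat_prod borel_measurable_matrix_mult borel_measurable_const
      measurable_component_singleton)
  have rv: "Z i \<in> borel_measurable M" if "i \<in> I" for i
    using ind that by (auto simp: indep_vars_def)
  have eq: "(\<integral>\<omega>. mat_prod (\<lambda>i. Q i ** Z (c i) \<omega>) n \<partial>M) =
      (\<integral>x. ?G x \<partial>distr M ?\<Pi> (\<lambda>\<omega>. \<lambda>i\<in>?S. Z (c i) \<omega>))" if "c ` ?S \<subseteq> I" for c
  proof (subst integral_distr[OF _ G])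
    show "(\<lambda>\<omega>. \<lambda>i\<in>?S. Z (c i) \<omega>) \<in> measurable M ?\<Pi>"
      using that by (intro measurable_restrict rv) blast
    show "(\<integral>\<omega>. mat_prod (\<lambda>i. Q i ** Z (c i) \<omega>) n \<partial>M) = (\<integral>\<omega>. ?G (\<lambda>i\<in>?S. Z (c i) \<omega>) \<partial>M)"
      by (intro Bochner_Integration.integral_cong refl mat_prod_cong) simp
  qed
  have "distr M ?\<Pi> (\<lambda>\<omega>. \<lambda>i\<in>?S. Z (a i) \<omega>) = distr M ?\<Pi> (\<lambda>\<omega>. \<lambda>i\<in>?S. Z (b i) \<omega>)"
    by (rule distr_iid_eq_if_same_kernel[OF ind D ab]) (use \<open>n \<ge> 1\<close> in auto)
  then show ?thesis
    by (simp only: eq[OF ab(1)] eq[OF ab(2)])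
qed

text \<open>The matrix at position \<open>k\<close> is independent of all others. By Fubini it can
  be integrated first, and the product is linear in it, so its zero mean annihilates the whole
  expectation.\<close>

lemma expectation_mat_prod_eq_0_if_singleton:
  fixes Z :: "nat \<Rightarrow> 'a \<Rightarrow> real ^ 'r ^ 'r"
  assumes ind: "indep_vars (\<lambda>_. borel) Z I" and mom: "\<And>i. i \<in> I \<Longrightarrow> has_moments M (Z i)"
    and b: "b ` {1..n} \<subseteq> I" and k: "k \<in> {1..n}" "\<And>i. i \<in> {1..n} \<Longrightarrow> b i = b k \<Longrightarrow> i = k"
    and mean: "expectation (Z (b k)) = 0"
  shows "(\<integral>\<omega>. mat_prod (\<lambda>i. Q i ** Z (b i) \<omega>) n \<partial>M) = 0"
proof -
  \<comment> \<open>The split is by values of \<open>b\<close>, since other positions may share a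
    matrix. The two sets are disjoint because the value at \<open>k\<close> occurs nowhere
    else.\<close>
  let ?A = "b ` ({1..n} - {k})" and ?B = "{b k}"
  let ?PA = "PiM ?A (\<lambda>_. borel :: (real ^ 'r ^ 'r) measure)"
    and ?PB = "PiM ?B (\<lambda>_. borel :: (real ^ 'r ^ 'r) measure)"
  let ?U = "\<lambda>\<omega>. \<lambda>i\<in>?A. Z i \<omega>" and ?V = "\<lambda>\<omega>. \<lambda>i\<in>?B. Z i \<omega>"
  let ?h = "\<lambda>u v. mat_prod ((\<lambda>i. Q i ** u (b i))(k := Q k ** v (b k))) n"
  have bk: "b k \<in> I" using b k by auto
  have "indep_var ?PA ?U ?PB ?V"
    using k b by (intro indep_var_restrict[OF ind]) auto
  then have U: "?U \<in> measurable M ?PA" and V: "?V \<in> measurable M ?PB"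
    and UV: "distr M ?PA ?U \<Otimes>\<^sub>M distr M ?PB ?V = distr M (?PA \<Otimes>\<^sub>M ?PB) (\<lambda>\<omega>. (?U \<omega>, ?V \<omega>))"
    unfolding indep_var_distribution_eq by auto
  interpret U: prob_space "distr M ?PA ?U" by (rule prob_space_distr[OF U])
  interpret V: prob_space "distr M ?PB ?V" by (rule prob_space_distr[OF V])
  interpret UV: pair_sigma_finite "distr M ?PA ?U" "distr M ?PB ?V" ..
  have h_fst: "(\<lambda>x. fst x (b i)) \<in> borel_measurable (?PA \<Otimes>\<^sub>M ?PB)" if "i \<in> {1..n} - {k}" for i
    by (rule measurable_compose[OF measurable_fst measurable_component_singleton]) (use that in auto)
  have h_snd: "(\<lambda>x. snd x (b k)) \<in> borel_measurable (?PA \<Otimes>\<^sub>M ?PB)"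
    by (rule measurable_compose[OF measurable_snd measurable_component_singleton]) auto
  have "(\<lambda>x. mat_prod (\<lambda>i. ((\<lambda>i. Q i ** fst x (b i))(k := Q k ** snd x (b k))) i) n)
      \<in> borel_measurable (?PA \<Otimes>\<^sub>M ?PB)"
  proof (rule borel_measurable_mat_prod)
    show "(\<lambda>x. ((\<lambda>i. Q i ** fst x (b i))(k := Q k ** snd x (b k))) i)
        \<in> borel_measurable (?PA \<Otimes>\<^sub>M ?PB)" if "i \<in> {1..n}" for i
      using that h_fst[of i] h_snd
      by (cases "i = k") (auto intro!: borel_measurable_matrix_mult)
  qed
  then have h: "(\<lambda>(u, v). ?h u v) \<in> borel_measurable (?PA \<Otimes>\<^sub>M ?PB)"
    by (simp add: case_prod_unfold del: fun_upd_apply)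
  have hUV: "mat_prod (\<lambda>i. Q i ** Z (b i) \<omega>) n = ?h (?U \<omega>) (?V \<omega>)" for \<omega>
    using k by (intro mat_prod_cong) auto
  have pair: "(\<lambda>\<omega>. (?U \<omega>, ?V \<omega>)) \<in> measurable M (?PA \<Otimes>\<^sub>M ?PB)"
    using U V by (rule measurable_Pair)
  have "has_moments M (\<lambda>\<omega>. mat_prod (\<lambda>i. Q i ** Z (b i) \<omega>) n)"
    using b by (intro has_moments_mat_prod
      has_moments_bounded_bilinear[OF bounded_bilinear_matrix_mult] has_moments_const mom) auto
  then have int: "integrable M (\<lambda>\<omega>. ?h (?U \<omega>) (?V \<omega>))"
    unfolding hUV by (rule has_moments_integrable)
  \<comment> \<open>With the other matrices frozen at \<open>u\<close>, the integrand is bounded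
    linear in the k-th matrix, and a linear map sends the mean 0 to 0.\<close>
  have inner: "(\<integral>v. ?h u v \<partial>distr M ?PB ?V) = 0" if "u \<in> space ?PA" for u
  proof -
    have hu: "?h u \<in> borel_measurable ?PB"
      using measurable_compose[OF measurable_Pair1'[OF that] h] by simp
    have "bounded_linear (\<lambda>y. mat_prod ((\<lambda>i. Q i ** u (b i))(k := Q k ** y)) n)"
      using k(1) by (intro bounded_linear_mat_prod
        bounded_bilinear.bounded_linear_right[OF bounded_bilinear_matrix_mult])
    note lin = this
    have "(\<integral>v. ?h u v \<partial>distr M ?PB ?V) =
        (\<integral>\<omega>. mat_prod ((\<lambda>i. Q i ** u (b i))(k := Q k ** Z (b k) \<omega>)) n \<partial>M)"
      by (subst integral_distr[OF V hu]) simp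
    also have "\<dots> = mat_prod ((\<lambda>i. Q i ** u (b i))(k := Q k ** expectation (Z (b k)))) n"
      by (rule integral_bounded_linear[OF lin has_moments_integrable[OF mom[OF bk]]])
    also have "\<dots> = 0"
      using linear_simps(3)[OF lin] by (simp only: mean)
    finally show ?thesis .
  qed
  have "(\<integral>\<omega>. mat_prod (\<lambda>i. Q i ** Z (b i) \<omega>) n \<partial>M) =
      (\<integral>x. (\<lambda>(u, v). ?h u v) x \<partial>distr M (?PA \<Otimes>\<^sub>M ?PB) (\<lambda>\<omega>. (?U \<omega>, ?V \<omega>)))"
    unfolding hUV by (subst integral_distr[OF pair h]) simp
  also have "\<dots> = (\<integral>u. (\<integral>v. ?h u v \<partial>distr M ?PB ?V) \<partial>distr M ?PA ?U)"
  proof (subst UV[symmetric], rule UV.integral_fst[symmetric])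
    show "integrable (distr M ?PA ?U \<Otimes>\<^sub>M distr M ?PB ?V) (\<lambda>(u, v). ?h u v)"
      unfolding UV using int by (subst integrable_distr_eq[OF pair h]) simp
  qed
  also have "\<dots> = (\<integral>u. 0 \<partial>distr M ?PA ?U)"
    by (intro Bochner_Integration.integral_cong refl inner) simp
  finally show ?thesis by simp
qed

text \<open>The common identity behind both expansions. It is stated for a general i.i.d. family so
  that it serves both the copies and the centered copies.\<close>

lemma expectation_mat_prod_sum:
  fixes Z :: "nat \<Rightarrow> 'a \<Rightarrow> real ^ 'r ^ 'r"
  assumes ind: "indep_vars (\<lambda>_. borel) Z {1..}" and D: "\<And>i. i \<ge> 1 \<Longrightarrow> distr M borel (Z i) = D"
    and mom: "\<And>i. i \<ge> 1 \<Longrightarrow> has_moments M (Z i)" and n: "n \<ge> 1"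
  shows "(\<integral>\<omega>. mat_prod (\<lambda>i. Q i ** (\<Sum>j=1..N. Z j \<omega>)) n \<partial>M) =
    (\<Sum>l=1..n. (\<Prod>k<l. real N - real k) *\<^sub>R moment_circ M Z Q n l)"
proof -
  let ?S = "{1..n}" and ?A = "{1..n} \<rightarrow>\<^sub>E {1..N}" and ?P = "{p. partition_on {1..n} p}"
  let ?F = "\<lambda>p. moment_part_circ M Z Q n p"
  have int: "integrable M (\<lambda>\<omega>. mat_prod (\<lambda>i. Q i ** Z (a i) \<omega>) n)" if "a \<in> ?A" for a
    using that by (intro has_moments_integrable has_moments_mat_prod
      has_moments_bounded_bilinear[OF bounded_bilinear_matrix_mult] has_moments_const mom) force
  \<comment> \<open>The map \<open>a\<close> and the block index of its kernel partition have the
    same kernel, so each term is a partition moment.\<close>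
  have kernel: "(\<integral>\<omega>. mat_prod (\<lambda>i. Q i ** Z (a i) \<omega>) n \<partial>M) = ?F (kernel_partition ?S a)"
    if "a \<in> ?A" for a
    unfolding moment_part_circ_def
  proof (rule expectation_mat_prod_eq_if_same_kernel[OF ind _ _ _ _ n])
    note p = partition_on_kernel_partition[of ?S a]
    show "a ` ?S \<subseteq> {1..}" using that by force
    show "block_index (kernel_partition ?S a) ` ?S \<subseteq> {1..}"
      using block_index_pos[OF p] by auto
    show "a i = a j \<longleftrightarrow> block_index (kernel_partition ?S a) i = block_index (kernel_partition ?S a) j"
      if "i \<in> ?S" "j \<in> ?S" for i j
      using block_index_eq_iff[OF p that] kernel_partition_same_block[OF that] by simp
  qed (simp add: D)
  have finP: "finite ?P" by (rule finitely_many_partition_on) simp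
  have finA: "finite ?A" by (rule finite_PiE) auto
  have "(\<integral>\<omega>. mat_prod (\<lambda>i. Q i ** (\<Sum>j=1..N. Z j \<omega>)) n \<partial>M) =
      (\<integral>\<omega>. (\<Sum>a\<in>?A. mat_prod (\<lambda>i. Q i ** Z (a i) \<omega>) n) \<partial>M)"
    by (simp only: bounded_bilinear.sum_right[OF bounded_bilinear_matrix_mult]
      mat_prod_sum[OF finite_atLeastAtMost])
  also have "\<dots> = (\<Sum>a\<in>?A. \<integral>\<omega>. mat_prod (\<lambda>i. Q i ** Z (a i) \<omega>) n \<partial>M)"
    using int by (rule Bochner_Integration.integral_sum)
  also have "\<dots> = (\<Sum>a\<in>?A. ?F (kernel_partition ?S a))"
    using kernel by (rule sum.cong[OF refl])
  \<comment> \<open>Maps are grouped by kernel; within a group the summand is constant, so the size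
    of the group becomes the coefficient.\<close>
  also have "\<dots> = (\<Sum>p\<in>?P. \<Sum>a\<in>{a \<in> ?A. kernel_partition ?S a = p}. ?F (kernel_partition ?S a))"
    by (rule sum.group[symmetric, OF finA finP]) (auto intro: partition_on_kernel_partition)
  also have "\<dots> = (\<Sum>p\<in>?P. (\<Prod>k<card p. real N - real k) *\<^sub>R ?F p)"
  proof (rule sum.cong[OF refl])
    fix p assume "p \<in> ?P"
    then have "card {a \<in> ?A. kernel_partition ?S a = p} = (\<Prod>k<card p. N - k)"
      using card_maps_with_kernel[of ?S "{1..N}" p] by simp
    then have "real (card {a \<in> ?A. kernel_partition ?S a = p}) = (\<Prod>k<card p. real N - real k)"
      by (simp only: of_nat_prod_diff)
    moreover have "(\<Sum>a\<in>{a \<in> ?A. kernel_partition ?S a = p}. ?F (kernel_partition ?S a)) =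
        (\<Sum>a\<in>{a \<in> ?A. kernel_partition ?S a = p}. ?F p)"
      by (rule sum.cong) auto
    ultimately show "(\<Sum>a\<in>{a \<in> ?A. kernel_partition ?S a = p}. ?F (kernel_partition ?S a)) =
        (\<Prod>k<card p. real N - real k) *\<^sub>R ?F p"
      by (simp only: sum_constant_scaleR)
  qed
  \<comment> \<open>Partitions are now grouped by their number of blocks; it is at least 1 because
    \<open>n\<close> is positive.\<close>
  also have "\<dots> = (\<Sum>l=1..n. \<Sum>p\<in>{p \<in> ?P. card p = l}. (\<Prod>k<card p. real N - real k) *\<^sub>R ?F p)"
  proof (rule sum.group[symmetric, OF finP])
    show "card ` ?P \<subseteq> {1..n}"
      using partition_on_bounds(1,2)[of "{1..n}"] n by fastforce
  qed simp
  also have "\<dots> = (\<Sum>l=1..n. (\<Prod>k<l. real N - real k) *\<^sub>R moment_circ M Z Q n l)"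
    by (intro sum.cong refl) (auto simp: moment_circ_def partitions_def scaleR_sum_right intro!: sum.cong)
  finally show ?thesis .
qed

text \<open>The element of a singleton block is the only position carrying its block index, so an
  unrepeated centered factor occurs in the product.\<close>

lemma moment_part_circ_singleton_eq_0:
  fixes Z :: "nat \<Rightarrow> 'a \<Rightarrow> real ^ 'r ^ 'r"
  assumes ind: "indep_vars (\<lambda>_. borel) Z {1..}"
    and mom: "\<And>i. i \<ge> 1 \<Longrightarrow> has_moments M (Z i)" and mean: "\<And>i. i \<ge> 1 \<Longrightarrow> expectation (Z i) = 0"
    and p: "partition_on {1..n} p" and B: "B \<in> p" "card B = 1"
  shows "moment_part_circ M Z Q n p = 0"
proof -
  obtain k where k: "B = {k}" using B(2) by (rule card_1_singletonE)
  have kn: "k \<in> {1..n}" using partition_onD1[OF p] B(1) k by blast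
  note pos = block_index_pos[OF p]
  have "i = k" if i: "i \<in> {1..n}" "block_index p i = block_index p k" for i
  proof -
    obtain C where "C \<in> p" "i \<in> C" "k \<in> C"
      using i block_index_eq_iff[OF p i(1) kn] by auto
    moreover from this have "C = B"
      using disjointD[OF partition_onD2[OF p], of C B] B(1) k by auto
    ultimately show ?thesis using k by simp
  qed
  then show ?thesis
    unfolding moment_part_circ_def
    by (intro expectation_mat_prod_eq_0_if_singleton[OF ind, where k = k])
      (use pos kn in \<open>auto intro!: mom mean\<close>)
qed

end

section \<open>Resummation with Stirling numbers\<close>

lemma prod_diff_eq_sum_stirling_signed:
  assumes "l \<ge> 1"
  shows "(\<Prod>k<l. real N - real k) = (\<Sum>m=1..l. of_int (stirling_signed l m) * real N ^ m)"
proof -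
  have "(\<Prod>k<l. real N - real k) = of_int (\<Prod>k<l. int N - int k)"
    by simp
  also have "\<dots> = (\<Sum>m=1..l. of_int (stirling_signed l m) * real N ^ m)"
    unfolding falling_factorial_eq_sum_stirling_signed[OF assms] by simp
  finally show ?thesis .
qed

text \<open>Each falling factorial is expanded in powers of \<open>N\<close>, and the sum over the
  triangle m \<le> l \<le> K is interchanged. The inner sums have the shape of the expansion
  coefficients, with \<open>K = n\<close> or \<open>K = n div 2\<close>.\<close>

lemma sum_prod_diff_scaleR:
  fixes V :: "nat \<Rightarrow> 'b::real_vector"
  shows "(\<Sum>l=1..K. (\<Prod>k<l. real N - real k) *\<^sub>R V l) =
    (\<Sum>m=1..K. real N ^ m *\<^sub>R (\<Sum>l=m..K. of_int (stirling_signed l m) *\<^sub>R V l))"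
proof -
  let ?f = "\<lambda>l m. (real N ^ m * of_int (stirling_signed l m)) *\<^sub>R V l"
  have "(\<Sum>l=1..K. (\<Prod>k<l. real N - real k) *\<^sub>R V l) = (\<Sum>l\<in>{1..K}. \<Sum>m\<in>{m \<in> {1..K}. m \<le> l}. ?f l m)"
  proof (rule sum.cong[OF refl])
    fix l assume l: "l \<in> {1..K}"
    then have "{m \<in> {1..K}. m \<le> l} = {1..l}" by auto
    then show "(\<Prod>k<l. real N - real k) *\<^sub>R V l = (\<Sum>m\<in>{m \<in> {1..K}. m \<le> l}. ?f l m)"
      using l by (simp add: prod_diff_eq_sum_stirling_signed scaleR_sum_left mult.commute)
  qed
  also have "\<dots> = (\<Sum>m\<in>{1..K}. \<Sum>l\<in>{l \<in> {1..K}. m \<le> l}. ?f l m)"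
    by (rule sum.swap_restrict) auto
  also have "\<dots> = (\<Sum>m=1..K. real N ^ m *\<^sub>R (\<Sum>l=m..K. of_int (stirling_signed l m) *\<^sub>R V l))"
  proof (rule sum.cong[OF refl])
    fix m assume "m \<in> {1..K}"
    then have "{l \<in> {1..K}. m \<le> l} = {m..K}" by auto
    then show "(\<Sum>l\<in>{l \<in> {1..K}. m \<le> l}. ?f l m) =
        real N ^ m *\<^sub>R (\<Sum>l=m..K. of_int (stirling_signed l m) *\<^sub>R V l)"
      by (simp add: scaleR_sum_right)
  qed
  finally show ?thesis .
qed

section \<open>Expansions for Gaussian sample covariance matrices and their fluctuations\<close>

theorem theorem1p1:
  fixes M :: "'a measure"
    and X :: "'a \<Rightarrow> real ^ 'r"
    and Y :: "nat \<Rightarrow> 'a \<Rightarrow> real ^ 'r ^ 'r"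
    and P :: "real ^ 'r ^ 'r"
    and Q :: "nat \<Rightarrow> real ^ 'r ^ 'r"
    and N n :: nat
  assumes "prob_space M"
    and "gaussian_vector M X"
    and "(\<integral>\<omega>. X \<omega> \<partial>M) = 0"
    and "covariance_matrix M X = P"
    and "prob_space.indep_vars M (\<lambda>_. borel) Y {1..}"
    and "\<And>i. i \<ge> 1 \<Longrightarrow> distr M borel (Y i) = distr M borel (\<lambda>\<omega>. outer_square (X \<omega>))"
    and "2 * N \<ge> n" and "n \<ge> 1"
  shows "(\<integral>\<omega>. mat_prod (\<lambda>i. Q i ** cov_fluctuation Y P N \<omega>) n \<partial>M) =
           (\<Sum>m=1..n div 2. (1 / real N powr (real n / 2 - real m)) *\<^sub>R expansion_coeff M Y Q P n m)
       \<and> (\<integral>\<omega>. mat_prod (\<lambda>i. Q i ** sample_cov Y N \<omega>) n \<partial>M) =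
           (\<Sum>m=1..n. (1 / real N ^ (n - m)) *\<^sub>R expansion_coeff_circ M Y Q n m)"
proof -
  interpret prob_space M by fact
  note X = \<open>gaussian_vector M X\<close>
  note ind = \<open>prob_space.indep_vars M (\<lambda>_. borel) Y {1..}\<close>
  note distrY = assms(6)
  have N: "N > 0" using assms(7,8) by simp
  let ?S = "\<lambda>\<omega>. outer_square (X \<omega>)"
  let ?Z = "\<lambda>i \<omega>. Y i \<omega> - P"
  have rvY: "Y i \<in> borel_measurable M" if "i \<ge> 1" for i
    using ind that by (auto simp: indep_vars_def)
  have momS: "has_moments M ?S" by (rule outer_square_has_moments[OF X])
  have momY: "has_moments M (Y i)" if "i \<ge> 1" for i
    using momS has_moments_distr[OF rvY[OF that]] has_moments_distr[OF has_moments_measurable[OF momS]]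
    by (simp add: distrY[OF that])
  have meanY: "expectation (Y i) = P" if "i \<ge> 1" for i
  proof -
    have "expectation (Y i) = (\<integral>x. x \<partial>distr M borel (Y i))"
      by (rule integral_distr[symmetric]) (use rvY[OF that] in auto)
    also have "\<dots> = expectation ?S"
      unfolding distrY[OF that] by (rule integral_distr) (use has_moments_measurable[OF momS] in auto)
    finally show ?thesis
      using expectation_outer_square[OF X assms(3)] assms(4) by simp
  qed
  have momZ: "has_moments M (?Z i)" if "i \<ge> 1" for i
    using has_moments_add[OF momY[OF that] has_moments_const[of "- P"]] by simp
  have meanZ: "expectation (?Z i) = 0" if "i \<ge> 1" for i
    using meanY[OF that] has_moments_integrable[OF momY[OF that]] by (simp add: prob_space)
  have indZ: "indep_vars (\<lambda>_. borel) ?Z {1..}"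
    by (rule indep_vars_compose2[OF ind]) auto
  \<comment> \<open>The right-hand side does not depend on \<open>i\<close>: it is the common law of
    the centered copies.\<close>
  have distrZ: "distr M borel (?Z i) = distr (distr M borel ?S) borel (\<lambda>A. A - P)" if "i \<ge> 1" for i
    using rvY[OF that] by (simp add: distr_distr comp_def flip: distrY[OF that])

  \<comment> \<open>Each of the \<open>n\<close> factors contributes 1/N; the remaining product of
    sums is the one already expanded.\<close>
  have "mat_prod (\<lambda>i. Q i ** sample_cov Y N \<omega>) n =
      (1 / real N) ^ n *\<^sub>R mat_prod (\<lambda>i. Q i ** (\<Sum>j=1..N. Y j \<omega>)) n" for \<omega>
    by (simp only: sample_cov_def bounded_bilinear.scaleR_right[OF bounded_bilinear_matrix_mult]
      mat_prod_scaleR)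
  then have "(\<integral>\<omega>. mat_prod (\<lambda>i. Q i ** sample_cov Y N \<omega>) n \<partial>M) =
      (1 / real N) ^ n *\<^sub>R (\<Sum>m=1..n. real N ^ m *\<^sub>R expansion_coeff_circ M Y Q n m)"
    by (simp only: integral_scaleR_right expectation_mat_prod_sum[OF ind distrY momY assms(8)]
      sum_prod_diff_scaleR expansion_coeff_circ_def)
  also have "\<dots> = (\<Sum>m=1..n. (1 / real N ^ (n - m)) *\<^sub>R expansion_coeff_circ M Y Q n m)"
    unfolding scaleR_sum_right
  proof (rule sum.cong[OF refl])
    fix m assume "m \<in> {1..n}"
    then have "(1 / real N) ^ n * real N ^ m = 1 / real N ^ (n - m)"
      using N by (simp add: power_diff power_one_over)
    then show "(1 / real N) ^ n *\<^sub>R real N ^ m *\<^sub>R expansion_coeff_circ M Y Q n m =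
        (1 / real N ^ (n - m)) *\<^sub>R expansion_coeff_circ M Y Q n m"
      by simp
  qed
  finally have circ: "(\<integral>\<omega>. mat_prod (\<lambda>i. Q i ** sample_cov Y N \<omega>) n \<partial>M) = \<dots>" .

  have zero: "moment_part_circ M ?Z Q n p = 0" if "p \<in> partitions n l - partitions_no_singleton n l" for p l
    using that by (auto simp: partitions_def partitions_no_singleton_def
      intro: moment_part_circ_singleton_eq_0[OF indZ momZ meanZ])
  have part: "moment_part M Y Q P n = moment_part_circ M ?Z Q n"
    by (simp only: fun_eq_iff moment_part_def moment_part_circ_def simp_thms)
  \<comment> \<open>For the centered copies, summing over all partitions or only over those without
    singletons gives the same value.\<close>
  have moment: "moment_circ M ?Z Q n l = moment M Y Q P n l" for l
    unfolding moment_circ_def moment_def part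
  proof (rule sum.mono_neutral_right[OF finite_partitions])
    show "partitions_no_singleton n l \<subseteq> partitions n l"
      by (auto simp: partitions_no_singleton_def)
  qed (use zero in blast)
  have "partitions_no_singleton n l = {}" if "l > n div 2" for l
    using that partition_on_bounds(3)[of "{1..n}"]
    by (fastforce simp: partitions_def partitions_no_singleton_def)
  then have vanish: "moment M Y Q P n l = 0" if "l > n div 2" for l
    using that by (simp add: moment_def)
  \<comment> \<open>The factor sqrt(N) of the fluctuation meets the 1/N of the sample mean; the
    matrix \<open>P\<close> is absorbed as the average of \<open>N\<close> copies of itself.\<close>
  let ?c = "sqrt (real N) / real N"
  have "cov_fluctuation Y P N \<omega> = ?c *\<^sub>R (\<Sum>j=1..N. ?Z j \<omega>)" for \<omega>
    using N by (simp add: cov_fluctuation_def sample_cov_def sum_subtractf sum_constant_scaleR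
      scaleR_diff_right del: sum_constant)
  then have "mat_prod (\<lambda>i. Q i ** cov_fluctuation Y P N \<omega>) n =
      ?c ^ n *\<^sub>R mat_prod (\<lambda>i. Q i ** (\<Sum>j=1..N. ?Z j \<omega>)) n" for \<omega>
    by (simp only: bounded_bilinear.scaleR_right[OF bounded_bilinear_matrix_mult] mat_prod_scaleR)
  then have "(\<integral>\<omega>. mat_prod (\<lambda>i. Q i ** cov_fluctuation Y P N \<omega>) n \<partial>M) =
      ?c ^ n *\<^sub>R (\<Sum>l=1..n. (\<Prod>k<l. real N - real k) *\<^sub>R moment M Y Q P n l)"
    by (simp only: integral_scaleR_right expectation_mat_prod_sum[OF indZ distrZ momZ assms(8)] moment)
  \<comment> \<open>Truncation at \<open>n div 2\<close> comes before the Stirling resummation, so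
    that the inner sums end there as \<open>expansion_coeff\<close> requires.\<close>
  also have "(\<Sum>l=1..n. (\<Prod>k<l. real N - real k) *\<^sub>R moment M Y Q P n l) =
      (\<Sum>l=1..n div 2. (\<Prod>k<l. real N - real k) *\<^sub>R moment M Y Q P n l)"
    by (rule sum.mono_neutral_right) (auto simp: vanish)
  also have "\<dots> = (\<Sum>m=1..n div 2. real N ^ m *\<^sub>R expansion_coeff M Y Q P n m)"
    by (simp only: sum_prod_diff_scaleR expansion_coeff_def)
  also have "?c ^ n *\<^sub>R \<dots> =
      (\<Sum>m=1..n div 2. (1 / real N powr (real n / 2 - real m)) *\<^sub>R expansion_coeff M Y Q P n m)"
    unfolding scaleR_sum_right
  proof (rule sum.cong[OF refl])
    fix m
    have pos: "0 < real N" "0 < real N powr (- (1 / 2))" using N by simp_all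
    \<comment> \<open>Real exponents are needed because n/2 - m is a half-integer for odd
      \<open>n\<close>.\<close>
    have "?c = real N powr (- (1 / 2))"
      using N by (simp add: powr_minus powr_half_sqrt field_simps)
    then have "?c ^ n * real N ^ m = (real N powr (- (1 / 2))) powr real n * real N powr real m"
      by (simp only: powr_realpow[OF pos(1)] powr_realpow[OF pos(2)])
    also have "\<dots> = real N powr (- (real n / 2 - real m))"
      by (simp add: powr_powr flip: powr_add)
    also have "\<dots> = 1 / real N powr (real n / 2 - real m)"
      by (rule powr_minus_divide)
    finally show "?c ^ n *\<^sub>R real N ^ m *\<^sub>R expansion_coeff M Y Q P n m =
        (1 / real N powr (real n / 2 - real m)) *\<^sub>R expansion_coeff M Y Q P n m"
      by simp
  qed
  finally show ?thesis using circ by blast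
qed

end
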